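(* Let $Z=w_1+jw_2=z_1e_1+z_2e_2$, $\mathcal{V}=\alpha+j\beta=\nu_1e_1+\nu_2e_2$, $C=c_1e_1+c_2e_2\in\mathbb{BC}$. Then, for a fixed $Z\notin\mathbb{O}_2$, the bicomplex Miller-Ross function $E_{\mathcal{V},C}(Z)$ is an analytic (bicomplex holomorphic) function of $\mathcal{V}$ and $C$.
   Context: Bicomplex numbers: $\mathbb{BC}=\{w_1+jw_2: w_1,w_2\in\mathbb{C}(i)\}$, where $\mathbb{C}(i)$ is the complex field with unit $i$, $i^2=j^2=-1$, $ij=ji$. Put $e_1=\frac{1+ij}{2}$, $e_2=\frac{1-ij}{2}$, so $e_1+e_2=1$, $e_l^2=e_l$, $e_1e_2=0$. Every $Z=w_1+jw_2$ is uniquely $Z=z_1e_1+z_2e_2$ with $z_1=w_1-iw_2$, $z_2=w_1+iw_2\in\mathbb{C}(i)$, and addition, multiplication and division are componentwise in $e_1,e_2$. The set of zero divisors is $\mathbb{O}_2=\{w_1+jw_2: w_1^2+w_2^2=0\}$, i.e. $z_1z_2=0$. Functions act componentwise: $\Gamma(Y)=\Gamma(y_1)e_1+\Gamma(y_2)e_2$ for $Y=y_1e_1+y_2e_2$ (with $1/\Gamma$ equal to $0$ at the poles of $\Gamma$), and $Z^{W}=z_1^{w_1}e_1+z_2^{w_2}e_2$ for $Z=z_1e_1+z_2e_2$, $W=w_1e_1+w_2e_2$ (principal complex powers). Bicomplex Miller-Ross function: $E_{\mathcal{V},C}(Z)=Z^{\mathcal{V}}\sum_{r=0}^{\infty}\frac{(CZ)^r}{\Gamma(\mathcal{V}+r+1)}$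 for $\mathcal{V},C,Z\in\mathbb{BC}$. A function $f:\Omega\subset\mathbb{BC}\to\mathbb{BC}$ is bicomplex holomorphic (analytic) in $\Omega$ if at each $Z_0\in\Omega$ the limit of $\frac{f(Z_0+\Delta Z)-f(Z_0)}{\Delta Z}$ as $\Delta Z\to0$, $\Delta Z\notin\mathbb{O}_2$, exists finitely. Equivalently, writing $f=f_1(w_1,w_2)+jf_2(w_1,w_2)$, the functions $f_1,f_2$ are holomorphic and satisfy $\frac{\partial f_1}{\partial w_1}=\frac{\partial f_2}{\partial w_2}$, $\frac{\partial f_1}{\partial w_2}=-\frac{\partial f_2}{\partial w_1}$. Analyticity in $\mathcal{V}$ and $C$ refers to this notion in each of the two variables. *)

theory Defs
  imports "HOL-Analysis.Analysis"
begin

text \<open>\<open>BC w\<^sub>1 w\<^sub>2\<close> stands for \<open>w\<^sub>1 + j w\<^sub>2\<close> with \<open>w\<^sub>1, w\<^sub>2 \<in> \<complex>(i)\<close>.\<close>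

codatatype bicomplex = BC (bc_fst: complex) (bc_snd: complex)

lemma bicomplex_eqI: "bc_fst x = bc_fst y \<Longrightarrow> bc_snd x = bc_snd y \<Longrightarrow> x = y"
  by (rule bicomplex.expand) simp

lemma bicomplex_eq_iff: "x = y \<longleftrightarrow> bc_fst x = bc_fst y \<and> bc_snd x = bc_snd y"
  by (auto intro: bicomplex.expand)

instantiation bicomplex :: comm_ring_1
begin

primcorec zero_bicomplex where
  "bc_fst 0 = 0"
| "bc_snd 0 = 0"

primcorec one_bicomplex where
  "bc_fst 1 = 1"
| "bc_snd 1 = 0"

primcorec plus_bicomplex where
  "bc_fst (x + y) = bc_fst x + bc_fst y"
| "bc_snd (x + y) = bc_snd x + bc_snd y"

primcorec uminus_bicomplex where
  "bc_fst (- x) = - bc_fst x"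
| "bc_snd (- x) = - bc_snd x"

primcorec minus_bicomplex where
  "bc_fst (x - y) = bc_fst x - bc_fst y"
| "bc_snd (x - y) = bc_snd x - bc_snd y"

primcorec times_bicomplex where
  "bc_fst (x * y) = bc_fst x * bc_fst y - bc_snd x * bc_snd y"
| "bc_snd (x * y) = bc_fst x * bc_snd y + bc_snd x * bc_fst y"

instance
  by standard (simp_all add: bicomplex_eq_iff algebra_simps)

end

instantiation bicomplex :: real_algebra_1
begin

primcorec scaleR_bicomplex where
  "bc_fst (r *\<^sub>R x) = r *\<^sub>R bc_fst x"
| "bc_snd (r *\<^sub>R x) = r *\<^sub>R bc_snd x"

instance
  by standard (simp_all add: bicomplex_eq_iff algebra_simps)

end

text \<open>The norm is the Euclidean one on \<open>\<complex>\<^sup>2 = \<real>\<^sup>4\<close>; it is submultiplicative only up to the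
  factor \<open>sqrt 2\<close>, so this is not an instance of \<open>real_normed_algebra\<close>.\<close>

instantiation bicomplex :: real_normed_vector
begin

definition norm_bicomplex :: "bicomplex \<Rightarrow> real" where
  "norm x = sqrt ((cmod (bc_fst x))\<^sup>2 + (cmod (bc_snd x))\<^sup>2)"

definition sgn_bicomplex :: "bicomplex \<Rightarrow> bicomplex" where
  "sgn x = x /\<^sub>R norm (x :: bicomplex)"

definition dist_bicomplex :: "bicomplex \<Rightarrow> bicomplex \<Rightarrow> real" where
  "dist x y = norm (x - y :: bicomplex)"

definition uniformity_bicomplex :: "(bicomplex \<times> bicomplex) filter" where
  "uniformity = (INF e\<in>{0 <..}. principal {(x :: bicomplex, y). dist x y < e})"

definition open_bicomplex :: "bicomplex set \<Rightarrow> bool" where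
  "open (U :: bicomplex set) \<longleftrightarrow> (\<forall>x\<in>U. eventually (\<lambda>(x', y). x' = x \<longrightarrow> y \<in> U) uniformity)"

instance
proof
  fix r :: real and x y :: bicomplex and U :: "bicomplex set"
  have norm_pair: "norm u = norm (bc_fst u, bc_snd u)" for u :: bicomplex
    by (simp add: norm_bicomplex_def norm_Pair)
  show "norm x = 0 \<longleftrightarrow> x = 0"
    by (simp add: norm_pair bicomplex_eq_iff zero_prod_def)
  show "norm (x + y) \<le> norm x + norm y"
    using norm_triangle_ineq[of "(bc_fst x, bc_snd x)" "(bc_fst y, bc_snd y)"]
    by (simp add: norm_pair)
  show "norm (r *\<^sub>R x) = \<bar>r\<bar> * norm x"
    using norm_scaleR[of r "(bc_fst x, bc_snd x)"]
    by (simp add: norm_pair del: norm_scaleR)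
qed (rule sgn_bicomplex_def dist_bicomplex_def uniformity_bicomplex_def open_bicomplex_def)+

end

definition bc_of_complex :: "complex \<Rightarrow> bicomplex" where
  "bc_of_complex w = BC w 0"

definition bc_i :: bicomplex where "bc_i = BC \<i> 0"

definition bc_j :: bicomplex where "bc_j = BC 0 1"

definition bc_e1 :: bicomplex where "bc_e1 = (1/2) *\<^sub>R (1 + bc_i * bc_j)"

definition bc_e2 :: bicomplex where "bc_e2 = (1/2) *\<^sub>R (1 - bc_i * bc_j)"

text \<open>The idempotent components \<open>z\<^sub>1, z\<^sub>2\<close> of \<open>Z = z\<^sub>1 e\<^sub>1 + z\<^sub>2 e\<^sub>2\<close>.\<close>

definition bc_comp1 :: "bicomplex \<Rightarrow> complex" where
  "bc_comp1 Z = bc_fst Z - \<i> * bc_snd Z"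

definition bc_comp2 :: "bicomplex \<Rightarrow> complex" where
  "bc_comp2 Z = bc_fst Z + \<i> * bc_snd Z"

definition bc_idem :: "complex \<Rightarrow> complex \<Rightarrow> bicomplex" where
  "bc_idem z1 z2 = bc_of_complex z1 * bc_e1 + bc_of_complex z2 * bc_e2"

lemma bc_i_j:
  "bc_i * bc_i = - 1" "bc_j * bc_j = - 1" "bc_i * bc_j = bc_j * bc_i"
  by (simp_all add: bicomplex_eq_iff bc_i_def bc_j_def)

lemma BC_eq: "BC w1 w2 = bc_of_complex w1 + bc_j * bc_of_complex w2"
  by (simp add: bicomplex_eq_iff bc_of_complex_def bc_j_def)

lemma bc_e1_e2:
  "bc_e1 + bc_e2 = 1" "bc_e1 * bc_e1 = bc_e1" "bc_e2 * bc_e2 = bc_e2" "bc_e1 * bc_e2 = 0"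
  by (simp_all add: bicomplex_eq_iff bc_e1_def bc_e2_def bc_i_def bc_j_def complex_eq_iff)

lemma bc_comp_idem [simp]:
  "bc_comp1 (bc_idem z1 z2) = z1" "bc_comp2 (bc_idem z1 z2) = z2"
  by (simp_all add: bc_idem_def bc_comp1_def bc_comp2_def bc_e1_def bc_e2_def bc_of_complex_def
      bc_i_def bc_j_def complex_eq_iff algebra_simps)

lemma bc_idem_comp: "bc_idem (bc_comp1 Z) (bc_comp2 Z) = Z"
  by (simp add: bc_idem_def bc_comp1_def bc_comp2_def bc_e1_def bc_e2_def bc_of_complex_def
      bc_i_def bc_j_def bicomplex_eq_iff complex_eq_iff algebra_simps)

lemma bc_eq_iff_comp: "X = Y \<longleftrightarrow> bc_comp1 X = bc_comp1 Y \<and> bc_comp2 X = bc_comp2 Y"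
  by (metis bc_idem_comp)

lemma bc_comp_mult:
  "bc_comp1 (X * Y) = bc_comp1 X * bc_comp1 Y" "bc_comp2 (X * Y) = bc_comp2 X * bc_comp2 Y"
  by (simp_all add: bc_comp1_def bc_comp2_def algebra_simps complex_eq_iff)

definition bc_zero_divisors :: "bicomplex set" where
  "bc_zero_divisors = {Z. (bc_fst Z)\<^sup>2 + (bc_snd Z)\<^sup>2 = 0}"

lemma bc_zero_divisors_iff: "Z \<in> bc_zero_divisors \<longleftrightarrow> bc_comp1 Z * bc_comp2 Z = 0"
  by (simp add: bc_zero_divisors_def bc_comp1_def bc_comp2_def algebra_simps power2_eq_square)

text \<open>The inverse is taken in each idempotent component, where \<open>inverse 0 = 0\<close>; it is the ring
  inverse exactly off \<open>bc_zero_divisors\<close>.\<close>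

instantiation bicomplex :: inverse
begin

definition inverse_bicomplex :: "bicomplex \<Rightarrow> bicomplex" where
  "inverse X = bc_idem (inverse (bc_comp1 X)) (inverse (bc_comp2 X))"

definition divide_bicomplex :: "bicomplex \<Rightarrow> bicomplex \<Rightarrow> bicomplex" where
  "X div Y = X * inverse (Y :: bicomplex)"

instance ..

end

lemma bc_divide_idem: "X / Y = bc_idem (bc_comp1 X / bc_comp1 Y) (bc_comp2 X / bc_comp2 Y)"
  by (simp add: bc_eq_iff_comp bc_comp_mult divide_bicomplex_def inverse_bicomplex_def divide_inverse)

lemma bc_mult_inverse: "Z \<notin> bc_zero_divisors \<Longrightarrow> Z * inverse Z = 1"
  by (auto simp: bc_zero_divisors_iff bc_eq_iff_comp bc_comp_mult inverse_bicomplex_def)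
    (simp_all add: bc_comp1_def bc_comp2_def)

definition bc_Gamma :: "bicomplex \<Rightarrow> bicomplex" where
  "bc_Gamma Y = bc_idem (Gamma (bc_comp1 Y)) (Gamma (bc_comp2 Y))"

text \<open>Since \<open>Gamma\<close> is \<open>0\<close> at its poles and \<open>inverse 0 = 0\<close>, the reciprocal \<open>1 / bc_Gamma\<close> has the
  value \<open>0\<close> in each component in which \<open>Gamma\<close> has a pole, as intended.\<close>

lemma bc_inverse_Gamma: "1 / bc_Gamma Y = bc_idem (rGamma (bc_comp1 Y)) (rGamma (bc_comp2 Y))"
  by (simp add: bc_eq_iff_comp bc_divide_idem bc_Gamma_def rGamma_inverse_Gamma divide_inverse)
    (simp add: bc_comp1_def bc_comp2_def)

definition bc_powr :: "bicomplex \<Rightarrow> bicomplex \<Rightarrow> bicomplex" where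
  "bc_powr Z W = bc_idem (bc_comp1 Z powr bc_comp1 W) (bc_comp2 Z powr bc_comp2 W)"

definition bc_miller_ross :: "bicomplex \<Rightarrow> bicomplex \<Rightarrow> bicomplex \<Rightarrow> bicomplex" where
  "bc_miller_ross V C Z = bc_powr Z V * (\<Sum>r. (C * Z) ^ r / bc_Gamma (V + of_nat r + 1))"

definition bc_holomorphic_on :: "(bicomplex \<Rightarrow> bicomplex) \<Rightarrow> bicomplex set \<Rightarrow> bool" where
  "bc_holomorphic_on f \<Omega> \<longleftrightarrow>
     (\<forall>Z0\<in>\<Omega>. \<exists>L. ((\<lambda>h. (f (Z0 + h) - f Z0) / h) \<longlongrightarrow> L)
        (at 0 within {h. Z0 + h \<in> \<Omega> \<and> h \<notin> bc_zero_divisors}))"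

end

theory Submission
  imports Defs "HOL-Complex_Analysis.Complex_Analysis"
begin

text \<open>
  All operations act in the idempotent components, so the function is a pair of classical
  Miller-Ross functions \<open>z powr \<nu> * (\<Sum>r. (c * z) ^ r * rGamma (\<nu> + r + 1))\<close>, and it suffices that
  these are entire in \<open>\<nu>\<close> and in \<open>c\<close>. On the half-plane \<open>Re \<nu> > 0\<close> the \<open>r\<close>-th coefficient is at
  most \<open>norm (rGamma (\<nu> + 1)) / r!\<close>, which gives locally uniform convergence there; splitting off
  the first \<open>N\<close> terms shifts \<open>\<nu>\<close> by \<open>N\<close> and carries this to the whole plane.
\<close>

section \<open>Classical series: entire in its order and in its argument\<close>

lemma norm_pochhammer_ge_fact:
  fixes z :: complex
  assumes "Re z \<ge> 1"
  shows "fact n \<le> norm (pochhammer z n)"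
proof (induction n)
  case (Suc n)
  \<comment> \<open>The new factor \<open>z + n\<close> has real part, hence modulus, at least
    \<open>n + 1\<close>, matching the new factor of the factorial.\<close>
  have "real (Suc n) \<le> Re (z + of_nat n)"
    using assms by simp
  also have "\<dots> \<le> norm (z + of_nat n)"
    by (rule complex_Re_le_cmod)
  finally have "real (Suc n) * fact n \<le> norm (z + of_nat n) * norm (pochhammer z n)"
    using Suc.IH by (intro mult_mono) auto
  then show ?case
    by (simp only: pochhammer_Suc norm_mult fact_Suc of_nat_mult of_nat_fact mult.commute)
qed simp

text \<open>The recurrence \<open>rGamma z = pochhammer z n * rGamma (z + n)\<close> turns the lower
  bound on the Pochhammer symbol into factorial decay.\<close>

lemma norm_rGamma_add_of_nat_le:
  fixes z :: complex
  assumes "Re z \<ge> 1"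
  shows "norm (rGamma (z + of_nat n)) \<le> norm (rGamma z) / fact n"
proof -
  have "norm (rGamma z) = norm (pochhammer z n) * norm (rGamma (z + of_nat n))"
    by (metis norm_mult pochhammer_rGamma)
  also have "\<dots> \<ge> fact n * norm (rGamma (z + of_nat n))"
    by (intro mult_right_mono norm_pochhammer_ge_fact assms) auto
  finally show ?thesis
    by (simp add: field_simps)
qed

text \<open>This is the Mittag-Leffler function with parameters 1 and \<open>\<nu> + 1\<close>.
  Using \<open>rGamma\<close> makes every coefficient entire in \<open>\<nu>\<close>.\<close>

definition miller_ross_series :: "complex \<Rightarrow> complex \<Rightarrow> complex" where
  "miller_ross_series \<nu> x = (\<Sum>r. x ^ r * rGamma (\<nu> + of_nat r + 1))"

text \<open>The bound separates \<open>\<nu>\<close> from \<open>r\<close>, so a local bound on the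
  single function \<open>rGamma (\<nu> + 1)\<close> yields a majorant that is uniform in
  \<open>\<nu>\<close>.\<close>

lemma norm_miller_ross_term_le:
  fixes x \<nu> :: complex
  assumes "Re \<nu> > 0"
  shows "norm (x ^ r * rGamma (\<nu> + of_nat r + 1)) \<le> norm (rGamma (\<nu> + 1)) * (norm x ^ r / fact r)"
proof -
  have "norm (rGamma (\<nu> + 1 + of_nat r)) \<le> norm (rGamma (\<nu> + 1)) / fact r"
    using assms by (intro norm_rGamma_add_of_nat_le) simp
  then have "norm x ^ r * norm (rGamma (\<nu> + 1 + of_nat r))
      \<le> norm x ^ r * (norm (rGamma (\<nu> + 1)) / fact r)"
    by (intro mult_left_mono) auto
  then show ?thesis
    by (simp add: norm_mult norm_power add_ac mult_ac)
qed

lemma summable_power_div_fact: "summable (\<lambda>r. (a :: real) ^ r / fact r)"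
  using summable_exp[of a] by (simp add: divide_inverse mult.commute)

lemma miller_ross_term_shift:
  fixes x \<nu> :: complex
  shows "x ^ (r + N) * rGamma (\<nu> + of_nat (r + N) + 1)
    = x ^ N * (x ^ r * rGamma ((\<nu> + of_nat N) + of_nat r + 1))"
  by (simp add: power_add add_ac mult_ac)

text \<open>Dropping enough initial terms raises the order into the right half-plane, where the
  exponential series dominates.\<close>

lemma summable_miller_ross:
  fixes x \<nu> :: complex
  shows "summable (\<lambda>r. x ^ r * rGamma (\<nu> + of_nat r + 1))"
proof -
  obtain N :: nat where "- Re \<nu> < of_nat N"
    using reals_Archimedean2 by blast
  then have "Re (\<nu> + of_nat N) > 0"
    by simp
  then have "summable (\<lambda>r. x ^ r * rGamma ((\<nu> + of_nat N) + of_nat r + 1))"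
    by (rule summable_comparison_test'[OF summable_mult[OF summable_power_div_fact]
          norm_miller_ross_term_le])
  from summable_mult[OF this, of "x ^ N"]
  have "summable (\<lambda>r. x ^ (r + N) * rGamma (\<nu> + of_nat (r + N) + 1))"
    by (simp only: miller_ross_term_shift)
  then show ?thesis
    by (rule summable_iff_shift[THEN iffD1])
qed

lemma miller_ross_series_holomorphic_right_half_plane:
  "(\<lambda>\<nu>. miller_ross_series \<nu> x) holomorphic_on {\<nu>. Re \<nu> > 0}"
proof -
  let ?S = "{\<nu>. Re \<nu> > 0}" and ?f = "\<lambda>r \<nu>. x ^ r * rGamma (\<nu> + of_nat r + 1)"
  have "open ?S"
    by (rule open_halfspace_Re_gt)
  have dominated: "\<exists>d h. 0 < d \<and> summable h \<and> range h \<subseteq> \<real>\<^sub>\<ge>\<^sub>0 \<and>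
      (\<forall>\<^sub>F n in sequentially. \<forall>y\<in>ball \<nu> d \<inter> ?S. norm (?f n y) \<le> norm (h n :: complex))" for \<nu>
  proof -
    \<comment> \<open>Since \<open>rGamma\<close> is entire, the closed disc may leave the
      half-plane and radius 1 serves for every \<open>\<nu>\<close>.\<close>
    have "compact ((\<lambda>y :: complex. rGamma (y + 1)) ` cball \<nu> 1)"
      by (intro compact_continuous_image holomorphic_on_imp_continuous_on holomorphic_intros) auto
    then obtain B where B: "B > 0" "\<And>y. y \<in> cball \<nu> 1 \<Longrightarrow> norm (rGamma (y + 1)) \<le> B"
      using bounded_pos compact_imp_bounded by (metis (no_types, lifting) imageI)
    \<comment> \<open>The comparison theorem expects a complex majorant with nonnegative real
      values, hence the embedding.\<close>
    let ?h = "\<lambda>r. complex_of_real (B * (norm x ^ r / fact r))"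
    have "summable ?h"
      by (intro summable_of_real summable_mult summable_power_div_fact)
    moreover have "range ?h \<subseteq> \<real>\<^sub>\<ge>\<^sub>0"
      using B(1) by (auto simp: nonneg_Reals_of_real_iff simp del: of_real_mult of_real_divide)
    moreover have "norm (?f r y) \<le> norm (?h r)" if "y \<in> ball \<nu> 1 \<inter> ?S" for r y
    proof -
      have "norm (?f r y) \<le> norm (rGamma (y + 1)) * (norm x ^ r / fact r)"
        using that by (intro norm_miller_ross_term_le) auto
      also have "\<dots> \<le> B * (norm x ^ r / fact r)"
        using that by (intro mult_right_mono B(2)) auto
      also have "\<dots> = norm (?h r)"
        using B(1) by (simp only: norm_of_real) simp
      finally show ?thesis .
    qed
    ultimately show ?thesis
      by (intro exI[of _ 1] exI[of _ ?h]) auto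
  qed
  have differentiable: "?f r field_differentiable at \<nu>" for r \<nu>
    by (rule holomorphic_on_imp_differentiable_at[of _ UNIV]) (auto intro!: holomorphic_intros)
  obtain g where g: "\<forall>\<nu>\<in>?S. (\<lambda>n. ?f n \<nu>) sums g \<nu> \<and> g field_differentiable at \<nu>"
    by (rule series_differentiable_comparison_complex[OF \<open>open ?S\<close> differentiable dominated])
  then have "g holomorphic_on ?S"
    by (auto simp: holomorphic_on_def intro: field_differentiable_at_within)
  then show ?thesis
    by (rule holomorphic_transform) (use g in \<open>auto simp: miller_ross_series_def sums_iff\<close>)
qed

lemma miller_ross_series_split:
  "miller_ross_series \<nu> x
    = x ^ N * miller_ross_series (\<nu> + of_nat N) x + (\<Sum>r<N. x ^ r * rGamma (\<nu> + of_nat r + 1))"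
  unfolding miller_ross_series_def
  by (subst suminf_split_initial_segment[OF summable_miller_ross, of _ _ N])
     (simp only: miller_ross_term_shift suminf_mult[OF summable_miller_ross])

text \<open>The open half-planes \<open>Re \<nu> > - N\<close> cover the plane. On each, splitting
  off \<open>N\<close> terms leaves a finite sum of entire functions and a series whose order has
  positive real part.\<close>

lemma miller_ross_series_holomorphic_order: "(\<lambda>\<nu>. miller_ross_series \<nu> x) holomorphic_on UNIV"
proof -
  have "(\<lambda>\<nu>. miller_ross_series \<nu> x) holomorphic_on {\<nu>. Re \<nu> > - real N}" for N
  proof -
    have "((\<lambda>\<nu>. miller_ross_series \<nu> x) \<circ> (\<lambda>\<nu>. \<nu> + of_nat N)) holomorphic_on {\<nu>. Re \<nu> > - real N}"
      by (intro holomorphic_on_compose_gen[OF _ miller_ross_series_holomorphic_right_half_plane]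
          holomorphic_intros) auto
    then show ?thesis
      by (subst miller_ross_series_split[of _ _ N]) (auto simp: o_def intro!: holomorphic_intros)
  qed
  then have "(\<lambda>\<nu>. miller_ross_series \<nu> x) holomorphic_on (\<Union>N. {\<nu>. Re \<nu> > - real N})"
    by (intro holomorphic_on_UN_open open_halfspace_Re_gt) auto
  also have "(\<Union>N. {\<nu>. Re \<nu> > - real N}) = UNIV"
    using reals_Archimedean2 by (auto simp: minus_less_iff)
  finally show ?thesis .
qed

text \<open>For fixed order this is a power series converging everywhere, so it can be
  differentiated term by term.\<close>

lemma miller_ross_series_holomorphic_argument: "miller_ross_series \<nu> holomorphic_on UNIV"
proof -
  have "(miller_ross_series \<nu> has_field_derivative
      (\<Sum>n. diffs (\<lambda>r. rGamma (\<nu> + of_nat r + 1)) n * x ^ n)) (at x)" for x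
    using termdiffs_strong_converges_everywhere[of "\<lambda>r. rGamma (\<nu> + of_nat r + 1)" x]
      summable_miller_ross[of _ \<nu>]
    by (simp add: miller_ross_series_def[abs_def] mult.commute)
  then show ?thesis
    by (auto simp: holomorphic_on_def field_differentiable_def)
qed

section \<open>Passage between bicomplex numbers and idempotent components\<close>

lemma bounded_linear_bc_comp: "bounded_linear bc_comp1" "bounded_linear bc_comp2"
proof -
  have le: "norm (bc_fst x) \<le> norm x" "norm (bc_snd x) \<le> norm x" for x
    by (auto simp: norm_bicomplex_def intro!: real_le_rsqrt)
  have "norm (bc_comp1 x) \<le> norm x * 2" for x
    using norm_triangle_ineq4[of "bc_fst x" "\<i> * bc_snd x"] le[of x]
    by (simp add: bc_comp1_def norm_mult)
  then show "bounded_linear bc_comp1"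
    by (intro bounded_linear_intro[of _ 2])
       (auto simp: bc_comp1_def scaleR_diff_right scaleR_add_right algebra_simps)
  have "norm (bc_comp2 x) \<le> norm x * 2" for x
    using norm_triangle_ineq[of "bc_fst x" "\<i> * bc_snd x"] le[of x]
    by (simp add: bc_comp2_def norm_mult)
  then show "bounded_linear bc_comp2"
    by (intro bounded_linear_intro[of _ 2])
       (auto simp: bc_comp2_def scaleR_diff_right scaleR_add_right algebra_simps)
qed

lemma bc_comp_simps:
  "bc_comp1 0 = 0" "bc_comp1 1 = 1" "bc_comp1 (X + Y) = bc_comp1 X + bc_comp1 Y"
  "bc_comp1 (X - Y) = bc_comp1 X - bc_comp1 Y" "bc_comp1 (r *\<^sub>R X) = r *\<^sub>R bc_comp1 X"
  "bc_comp2 0 = 0" "bc_comp2 1 = 1" "bc_comp2 (X + Y) = bc_comp2 X + bc_comp2 Y"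
  "bc_comp2 (X - Y) = bc_comp2 X - bc_comp2 Y" "bc_comp2 (r *\<^sub>R X) = r *\<^sub>R bc_comp2 X"
  by (simp_all add: bc_comp1_def bc_comp2_def scaleR_diff_right scaleR_add_right algebra_simps)

lemma bc_comp_of_nat: "bc_comp1 (of_nat n) = of_nat n" "bc_comp2 (of_nat n) = of_nat n"
  by (induction n) (simp_all add: bc_comp_simps)

lemma bc_comp_power: "bc_comp1 (X ^ n) = bc_comp1 X ^ n" "bc_comp2 (X ^ n) = bc_comp2 X ^ n"
  by (induction n) (simp_all add: bc_comp_simps bc_comp_mult)

text \<open>Stated on pairs so that limits of the two components combine into a limit in the
  bicomplex norm.\<close>

lemma bounded_linear_bc_idem: "bounded_linear (\<lambda>p. bc_idem (fst p) (snd p))"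
proof (rule bounded_linear_intro[of _ 2])
  fix p :: "complex \<times> complex"
  have "bc_fst (bc_idem (fst p) (snd p)) = (fst p + snd p) / 2"
       "bc_snd (bc_idem (fst p) (snd p)) = \<i> * (fst p - snd p) / 2"
    by (simp_all add: bc_idem_def bc_e1_def bc_e2_def bc_of_complex_def bc_i_def bc_j_def
        complex_eq_iff)
  then have "norm (bc_idem (fst p) (snd p)) \<le> norm ((fst p + snd p) / 2) + norm ((fst p - snd p) / 2)"
    using sqrt_sum_squares_le_sum[of "norm ((fst p + snd p) / 2)" "norm ((fst p - snd p) / 2)"]
    by (simp only: norm_bicomplex_def) (simp add: norm_mult norm_divide)
  also have "\<dots> \<le> norm (fst p) + norm (snd p)"
    using norm_triangle_ineq[of "fst p" "snd p"] norm_triangle_ineq4[of "fst p" "snd p"]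
    by (simp add: norm_divide)
  also have "\<dots> \<le> norm p * 2"
    using norm_fst_le[of "fst p" "snd p"] norm_snd_le[of "snd p" "fst p"] by simp
  finally show "norm (bc_idem (fst p) (snd p)) \<le> norm p * 2" .
qed (simp_all add: bc_eq_iff_comp bc_comp_simps)

lemma tendsto_bc_idem:
  assumes "(f \<longlongrightarrow> a) F" "(g \<longlongrightarrow> b) F"
  shows "((\<lambda>x. bc_idem (f x) (g x)) \<longlongrightarrow> bc_idem a b) F"
  using bounded_linear.tendsto[OF bounded_linear_bc_idem tendsto_Pair[OF assms]] by simp

lemma sums_bc_idem:
  assumes "f sums a" "g sums b"
  shows "(\<lambda>n. bc_idem (f n) (g n)) sums bc_idem a b"
proof -
  have "(\<Sum>n\<in>A. bc_idem (f n) (g n)) = bc_idem (\<Sum>n\<in>A. f n) (\<Sum>n\<in>A. g n)" for A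
    by (simp add: bc_eq_iff_comp bounded_linear_bc_comp[THEN bounded_linear.linear, THEN linear_sum])
  then show ?thesis
    using assms by (simp add: sums_def tendsto_bc_idem)
qed

text \<open>The bicomplex sum is a limit in the bicomplex norm; convergence of both component series
  identifies it, and the remaining product acts componentwise.\<close>

lemma bc_miller_ross_components:
  "bc_miller_ross V C Z = bc_idem
    (bc_comp1 Z powr bc_comp1 V * miller_ross_series (bc_comp1 V) (bc_comp1 C * bc_comp1 Z))
    (bc_comp2 Z powr bc_comp2 V * miller_ross_series (bc_comp2 V) (bc_comp2 C * bc_comp2 Z))"
proof -
  have "(C * Z) ^ r / bc_Gamma (V + of_nat r + 1) = bc_idem
      ((bc_comp1 C * bc_comp1 Z) ^ r * rGamma (bc_comp1 V + of_nat r + 1))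
      ((bc_comp2 C * bc_comp2 Z) ^ r * rGamma (bc_comp2 V + of_nat r + 1))" for r
    by (simp add: bc_divide_idem bc_Gamma_def bc_comp_simps bc_comp_of_nat bc_comp_power
        bc_comp_mult rGamma_inverse_Gamma divide_inverse)
  moreover have "(\<lambda>r. bc_idem
      ((bc_comp1 C * bc_comp1 Z) ^ r * rGamma (bc_comp1 V + of_nat r + 1))
      ((bc_comp2 C * bc_comp2 Z) ^ r * rGamma (bc_comp2 V + of_nat r + 1))) sums
    bc_idem (miller_ross_series (bc_comp1 V) (bc_comp1 C * bc_comp1 Z))
      (miller_ross_series (bc_comp2 V) (bc_comp2 C * bc_comp2 Z))"
    unfolding miller_ross_series_def by (intro sums_bc_idem summable_sums summable_miller_ross)
  ultimately have "(\<Sum>r. (C * Z) ^ r / bc_Gamma (V + of_nat r + 1)) =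
    bc_idem (miller_ross_series (bc_comp1 V) (bc_comp1 C * bc_comp1 Z))
      (miller_ross_series (bc_comp2 V) (bc_comp2 C * bc_comp2 Z))"
    by (simp only: sums_iff)
  then show ?thesis
    by (simp only: bc_miller_ross_def bc_powr_def) (simp add: bc_eq_iff_comp bc_comp_mult)
qed

text \<open>Only increments outside the zero divisors are admitted, so both components of the
  increment stay nonzero and the difference quotient splits.\<close>

lemma bc_holomorphic_on_bc_idem:
  assumes "f holomorphic_on UNIV" "g holomorphic_on UNIV"
  shows "bc_holomorphic_on (\<lambda>X. bc_idem (f (bc_comp1 X)) (g (bc_comp2 X))) UNIV"
  unfolding bc_holomorphic_on_def
proof
  fix X :: bicomplex
  let ?F = "at 0 within {h. X + h \<in> UNIV \<and> h \<notin> bc_zero_divisors}"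
  have comp: "filterlim bc_comp1 (at 0) ?F" "filterlim bc_comp2 (at 0) ?F"
    using bounded_linear_bc_comp[THEN bounded_linear.tendsto, OF tendsto_ident_at[of "0::bicomplex"]]
    by (auto simp: filterlim_at eventually_at_filter bc_zero_divisors_iff bc_comp_simps)
  have "((\<lambda>h. (f (bc_comp1 X + h) - f (bc_comp1 X)) / h) \<longlongrightarrow> deriv f (bc_comp1 X)) (at 0)"
       "((\<lambda>h. (g (bc_comp2 X + h) - g (bc_comp2 X)) / h) \<longlongrightarrow> deriv g (bc_comp2 X)) (at 0)"
    by (auto intro!: DERIV_D holomorphic_derivI[of _ UNIV] assms)
  \<comment> \<open>The limit \<open>L\<close> is the idempotent combination of the two complex
    derivatives.\<close>
  from tendsto_bc_idem[OF filterlim_compose[OF this(1) comp(1)] filterlim_compose[OF this(2) comp(2)]]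
  show "\<exists>L. ((\<lambda>h. (bc_idem (f (bc_comp1 (X + h))) (g (bc_comp2 (X + h)))
      - bc_idem (f (bc_comp1 X)) (g (bc_comp2 X))) / h) \<longlongrightarrow> L) ?F"
    by (auto simp: bc_divide_idem bc_comp_simps)
qed

theorem theorem5p1:
  fixes Z :: bicomplex
  assumes "Z \<notin> bc_zero_divisors"
  shows "(\<forall>C. bc_holomorphic_on (\<lambda>V. bc_miller_ross V C Z) UNIV) \<and>
         (\<forall>V. bc_holomorphic_on (\<lambda>C. bc_miller_ross V C Z) UNIV)"
proof (intro conjI allI)
  \<comment> \<open>The base is fixed and only the exponent varies, so the branch cut of the
    logarithm does not interfere.\<close>
  have order: "(\<lambda>\<nu>. z powr \<nu> * miller_ross_series \<nu> x) holomorphic_on UNIV" for z x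
    by (intro holomorphic_intros miller_ross_series_holomorphic_order)
  show "bc_holomorphic_on (\<lambda>V. bc_miller_ross V C Z) UNIV" for C
    unfolding bc_miller_ross_components by (intro bc_holomorphic_on_bc_idem order)
  have "(miller_ross_series \<nu> \<circ> (\<lambda>c. c * z)) holomorphic_on UNIV" for \<nu> z
    by (intro holomorphic_on_compose_gen[OF _ miller_ross_series_holomorphic_argument]
        holomorphic_intros) auto
  then have argument: "(\<lambda>c. z powr \<nu> * miller_ross_series \<nu> (c * z)) holomorphic_on UNIV" for \<nu> z
    by (auto simp: o_def intro!: holomorphic_intros)
  show "bc_holomorphic_on (\<lambda>C. bc_miller_ross V C Z) UNIV" for V
    unfolding bc_miller_ross_components
    by (intro bc_holomorphic_on_bc_idem[where f = "\<lambda>c. bc_comp1 Z powr bc_comp1 V *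
          miller_ross_series (bc_comp1 V) (c * bc_comp1 Z)"
        and g = "\<lambda>c. bc_comp2 Z powr bc_comp2 V *
          miller_ross_series (bc_comp2 V) (c * bc_comp2 Z)"] argument)
qed

end
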